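(* Let $ABC$ be a triangle with side lengths $a=|BC|$, $b=|AC|$, $c=|AB|$ satisfying $a<b<c$. If a minimum area isosceles container for $ABC$ is acute, then it is a special container of the first kind associated with $ABC$.
   Context: Triangles are non-degenerate closed triangular regions in the plane. A triangle is acute if all its angles are less than $90^\circ$. An isosceles triangle is one with at least two sides of equal length. An isosceles container for a triangle $T$ is an isosceles triangle $T'$ with $T\subseteq T'$; it is a minimum area isosceles container if its area is at most that of every isosceles container for $T$. $\vec{XY}$ denotes the ray starting at $X$ and passing through $Y$. Let $ABC$ be a triangle with $a=|BC|<b=|AC|<c=|AB|$. Special containers of the first kind associated with $ABC$: the isosceles triangles $AB'C$, $ABC'$, $ABC''$, where $B'$ is the point on the ray $\vec{CB}$ with $|B'C|=|AC|=b$; $C'$ is the point on the ray $\vec{AC}$ with $|AC'|=c$; $C''$ is the point on the ray $\vec{BC}$ with $|BC''|=c$. *)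

theory Defs
  imports "HOL-Analysis.Analysis"
begin

type_synonym plane = "real ^ 2"

(* A triangle is a region; P, Q, R are its vertices in some order (they are the
   extreme points of T, hence determined by T up to order). *)
definition triangle_with_vertices :: "plane set \<Rightarrow> plane \<Rightarrow> plane \<Rightarrow> plane \<Rightarrow> bool" where
  "triangle_with_vertices T P Q R \<longleftrightarrow> \<not> collinear {P, Q, R} \<and> T = convex hull {P, Q, R}"

definition area :: "plane set \<Rightarrow> real" where
  "area T = measure lebesgue T"

definition angle_at :: "plane \<Rightarrow> plane \<Rightarrow> plane \<Rightarrow> real" where
  "angle_at Q P R = arccos (((P - Q) \<bullet> (R - Q)) / (norm (P - Q) * norm (R - Q)))"

definition acute_triangle :: "plane set \<Rightarrow> bool" where
  "acute_triangle T \<longleftrightarrow>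
    (\<exists>P Q R. triangle_with_vertices T P Q R \<and>
      angle_at P Q R < pi / 2 \<and> angle_at Q R P < pi / 2 \<and> angle_at R P Q < pi / 2)"

(* The existential ranges over all orderings of the vertices, so this says that
   some two of the three sides have equal length. *)
definition isosceles_triangle :: "plane set \<Rightarrow> bool" where
  "isosceles_triangle T \<longleftrightarrow>
    (\<exists>P Q R. triangle_with_vertices T P Q R \<and> dist P Q = dist P R)"

definition isosceles_container :: "plane set \<Rightarrow> plane set \<Rightarrow> bool" where
  "isosceles_container T T' \<longleftrightarrow> isosceles_triangle T' \<and> T \<subseteq> T'"

definition min_area_isosceles_container :: "plane set \<Rightarrow> plane set \<Rightarrow> bool" where
  "min_area_isosceles_container T T' \<longleftrightarrow>
    isosceles_container T T' \<and> (\<forall>S. isosceles_container T S \<longrightarrow> area T' \<le> area S)"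

definition ray :: "plane \<Rightarrow> plane \<Rightarrow> plane set" where
  "ray X Y = {X + t *\<^sub>R (Y - X) | t. t \<ge> 0}"

(* For X \<noteq> Y and r \<ge> 0 the ray from X through Y has exactly one point at
   distance r from X, so each existential below picks out the point B', C', C''
   of the three containers A B' C, A B C', A B C''. *)
definition special_container_first_kind ::
    "plane \<Rightarrow> plane \<Rightarrow> plane \<Rightarrow> plane set \<Rightarrow> bool" where
  "special_container_first_kind A B C T \<longleftrightarrow>
    (\<exists>B' \<in> ray C B. dist B' C = dist A C \<and> T = convex hull {A, B', C}) \<or>
    (\<exists>C' \<in> ray A C. dist A C' = dist A B \<and> T = convex hull {A, B, C'}) \<or>
    (\<exists>C'' \<in> ray B C. dist B C'' = dist A B \<and> T = convex hull {A, B, C''})"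

end

theory Submission
  imports Defs
begin

text \<open>
  If an optimal acute container has a vertex \<open>X\<close> of the triangle at its apex, then comparing it with the
  isosceles container that has apex \<open>X\<close> and the angle of the triangle there shows that the two coincide,
  and the latter is special of the first kind. So suppose that no vertex lies at the apex. Each leg carries
  a vertex other than its base endpoint, as otherwise a flatter container is smaller, and the base is
  touched by the third vertex. If that vertex is interior to the base, the triangle can be rotated inside
  the container while its vertices slide along the three sides and it grows, which contradicts optimality.
  If it is a base vertex of the container, sliding the apex along a leg changes the area to first order,
  except in one critical configuration; there a container with apex at that base vertex is smaller.
\<close>

section \<open>Coordinates, cross products and doubled areas in the plane\<close>

definition crs :: "plane \<Rightarrow> plane \<Rightarrow> real" where
  "crs u v = u $ 1 * v $ 2 - u $ 2 * v $ 1"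

text \<open>A polynomial substitute for Lebesgue measure: all optimality arguments compare these
  values, and the measure enters only through \<open>area_triangle\<close>.\<close>

definition dbl_area :: "plane \<Rightarrow> plane \<Rightarrow> plane \<Rightarrow> real" where
  "dbl_area P Q R = \<bar>crs (Q - P) (R - P)\<bar>"

lemma inner_plane: "(u::plane) \<bullet> v = u $ 1 * v $ 1 + u $ 2 * v $ 2"
  by (simp add: inner_vec_def sum_2)

lemma norm_plane: "(norm (u::plane))\<^sup>2 = (u $ 1)\<^sup>2 + (u $ 2)\<^sup>2"
  unfolding power2_norm_eq_inner inner_plane by (simp add: power2_eq_square)

lemma plane_eq_iff: "(u::plane) = v \<longleftrightarrow> u $ 1 = v $ 1 \<and> u $ 2 = v $ 2"
  by (auto simp: vec_eq_iff forall_2)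

text \<open>Lagrange's identity. It expresses areas by inner products, so that whatever scales inner
  products scales areas too.\<close>

lemma crs_square: "(crs u v)\<^sup>2 = (norm u)\<^sup>2 * (norm v)\<^sup>2 - (u \<bullet> v)\<^sup>2"
  unfolding norm_plane inner_plane crs_def by (simp add: power2_eq_square algebra_simps)

lemma dbl_area_square:
  "(dbl_area P Q R)\<^sup>2 = (norm (Q - P))\<^sup>2 * (norm (R - P))\<^sup>2 - ((Q - P) \<bullet> (R - P))\<^sup>2"
  by (simp add: dbl_area_def crs_square)

lemma dbl_area_nonneg: "0 \<le> dbl_area P Q R"
  by (simp add: dbl_area_def)

lemma dbl_area_swap: "dbl_area P R Q = dbl_area P Q R"
  by (simp add: dbl_area_def crs_def abs_minus_commute mult.commute)

lemma area_triangle: "area (convex hull {P, Q, R}) = dbl_area P Q R / 2"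
proof -
  \<comment> \<open>On Borel sets the measures of \<open>lebesgue\<close> and \<open>lborel\<close>
    agree, and the hull is compact.\<close>
  have "convex hull {P, Q, R} \<in> sets borel"
    by (intro borel_closed compact_imp_closed compact_convex_hull) simp
  then have "area (convex hull {P, Q, R}) = measure lborel (convex hull {P, Q, R})"
    by (simp add: area_def)
  also have "\<dots> = dbl_area P Q R / 2"
    unfolding content_triangle dbl_area_def crs_def
    by (simp add: algebra_simps abs_minus_commute)
  finally show ?thesis .
qed

text \<open>This is the equality case of Cauchy-Schwarz, squared and combined with Lagrange's
  identity.\<close>

lemma collinear_iff_dbl_area: "collinear {P, Q, R} \<longleftrightarrow> dbl_area P Q R = 0"
proof -
  have "collinear {P, Q, R} \<longleftrightarrow> collinear {Q, P, R}"
    by (simp add: insert_commute)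
  also have "\<dots> \<longleftrightarrow> collinear {0, Q - P, R - P}"
    by (rule collinear_3) simp
  also have "\<dots> \<longleftrightarrow> \<bar>(Q - P) \<bullet> (R - P)\<bar> = norm (Q - P) * norm (R - P)"
    by (rule norm_cauchy_schwarz_equal[symmetric])
  also have "\<dots> \<longleftrightarrow> \<bar>(Q - P) \<bullet> (R - P)\<bar>\<^sup>2 = (norm (Q - P) * norm (R - P))\<^sup>2"
    by (smt (verit) abs_ge_zero mult_nonneg_nonneg norm_ge_zero power2_eq_iff_nonneg)
  also have "\<dots> \<longleftrightarrow> (dbl_area P Q R)\<^sup>2 = 0"
    by (auto simp: dbl_area_square power_mult_distrib)
  finally show ?thesis
    by simp
qed

section \<open>Similarities of the plane\<close>

text \<open>Reflections are included: the mirror image that exchanges the two legs has to be one of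
  these maps. The ratio \<open>k\<close> is explicit because areas scale by its square.\<close>

definition similarity :: "real \<Rightarrow> (plane \<Rightarrow> plane) \<Rightarrow> bool" where
  "similarity k f \<longleftrightarrow>
    k > 0 \<and> (\<exists>c g. orthogonal_transformation g \<and> f = (\<lambda>x. c + k *\<^sub>R g x))"

lemma similarity_inner:
  assumes "similarity k f"
  shows "(f Q - f P) \<bullet> (f R - f P) = k\<^sup>2 * ((Q - P) \<bullet> (R - P))"
proof -
  obtain c g where g: "orthogonal_transformation g" "f = (\<lambda>x. c + k *\<^sub>R g x)"
    using assms by (auto simp: similarity_def)
  have "linear g" "\<And>v w. g v \<bullet> g w = v \<bullet> w"
    using g(1) by (auto simp: orthogonal_transformation_def)
  have "f X - f P = k *\<^sub>R g (X - P)" for X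
    using g(2) by (simp add: linear_diff[OF \<open>linear g\<close>] scaleR_diff_right)
  then show ?thesis
    using \<open>\<And>v w. g v \<bullet> g w = v \<bullet> w\<close> by (simp add: power2_eq_square)
qed

lemma similarity_norm:
  assumes "similarity k f"
  shows "norm (f Q - f P) = k * norm (Q - P)"
proof -
  have "(norm (f Q - f P))\<^sup>2 = (k * norm (Q - P))\<^sup>2"
    using similarity_inner[OF assms, of Q P Q]
    by (simp add: power2_norm_eq_inner[symmetric] power_mult_distrib)
  then show ?thesis
    using assms by (simp add: similarity_def)
qed

lemma similarity_dbl_area:
  assumes "similarity k f"
  shows "dbl_area (f P) (f Q) (f R) = k\<^sup>2 * dbl_area P Q R"
proof -
  have "(dbl_area (f P) (f Q) (f R))\<^sup>2 = (k\<^sup>2 * dbl_area P Q R)\<^sup>2"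
    unfolding power_mult_distrib dbl_area_square similarity_inner[OF assms] similarity_norm[OF assms]
    by (simp add: algebra_simps power2_eq_square)
  then show ?thesis
    by (simp add: dbl_area_nonneg)
qed

lemma similarity_convex_hull:
  assumes "similarity k f"
  shows "f ` (convex hull S) = convex hull (f ` S)"
proof -
  obtain c g where g: "orthogonal_transformation g" "f = (\<lambda>x. c + k *\<^sub>R g x)"
    using assms by (auto simp: similarity_def)
  have *: "f ` S = (\<lambda>x. c + k *\<^sub>R x) ` (g ` S)" for S
    by (auto simp: g(2))
  show ?thesis
    unfolding * convex_hull_affinity
    using g(1) by (simp add: convex_hull_linear_image orthogonal_transformation_linear)
qed

lemma similarity_inverse:
  assumes "similarity k f"
  obtains f' where "similarity (1 / k) f'" "\<And>x. f' (f x) = x" "\<And>x. f (f' x) = x"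
proof -
  obtain c g where g: "orthogonal_transformation g" "f = (\<lambda>x. c + k *\<^sub>R g x)" and "k > 0"
    using assms by (auto simp: similarity_def)
  define g' where "g' = inv g"
  have g': "orthogonal_transformation g'" "\<And>x. g' (g x) = x" "\<And>x. g (g' x) = x"
    using g(1) orthogonal_transformation_bij[OF g(1)]
    by (auto simp: g'_def orthogonal_transformation_inv bij_def inv_f_f surj_f_inv_f)
  have lin: "linear g" "linear g'"
    using g(1) g'(1) by (auto simp: orthogonal_transformation_linear)
  define f' where "f' = (\<lambda>x. - ((1 / k) *\<^sub>R g' c) + (1 / k) *\<^sub>R g' x)"
  show thesis
  proof
    show "similarity (1 / k) f'"
      unfolding similarity_def f'_def using g'(1) \<open>k > 0\<close>
      by (intro conjI exI[of _ "- ((1 / k) *\<^sub>R g' c)"] exI[of _ g']) auto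
    show "f' (f x) = x" "f (f' x) = x" for x
      using \<open>k > 0\<close> g'(2,3)
      by (simp_all add: f'_def g(2) linear_add[OF lin(1)] linear_add[OF lin(2)]
          linear_diff[OF lin(1)] linear_cmul[OF lin(1)] linear_cmul[OF lin(2)] algebra_simps)
  qed
qed

section \<open>Optimal isosceles containers\<close>

text \<open>The apex is \<open>P\<close>; the container is that of a point set \<open>V\<close>, the vertices of the triangle.\<close>

definition optimal :: "plane set \<Rightarrow> plane \<Rightarrow> plane \<Rightarrow> plane \<Rightarrow> bool" where
  "optimal V P Q R \<longleftrightarrow>
    V \<subseteq> convex hull {P, Q, R} \<and> norm (Q - P) = norm (R - P) \<and> dbl_area P Q R > 0 \<and>
    (\<forall>P' Q' R'. V \<subseteq> convex hull {P', Q', R'} \<longrightarrow> norm (Q' - P') = norm (R' - P') \<longrightarrow>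
       dbl_area P' Q' R' > 0 \<longrightarrow> dbl_area P Q R \<le> dbl_area P' Q' R')"

lemma optimalD:
  assumes "optimal V P Q R"
  shows "V \<subseteq> convex hull {P, Q, R}" "norm (Q - P) = norm (R - P)" "dbl_area P Q R > 0"
  using assms by (auto simp: optimal_def)

lemma optimal_le:
  assumes "optimal V P Q R" "V \<subseteq> convex hull {P', Q', R'}" "norm (Q' - P') = norm (R' - P')"
    "dbl_area P' Q' R' > 0"
  shows "dbl_area P Q R \<le> dbl_area P' Q' R'"
  using assms unfolding optimal_def by blast

lemma optimal_swap: "optimal V P Q R \<longleftrightarrow> optimal V P R Q"
  by (simp add: optimal_def dbl_area_swap insert_commute eq_commute)

text \<open>A competitor for the image is pulled back by the inverse similarity, and all areas
  change by the same factor.\<close>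

lemma optimal_similarity:
  assumes opt: "optimal V P Q R" and f: "similarity k f"
  shows "optimal (f ` V) (f P) (f Q) (f R)"
  unfolding optimal_def
proof (intro conjI allI impI)
  have "k > 0"
    using f by (simp add: similarity_def)
  have hull: "f ` (convex hull {P, Q, R}) = convex hull {f P, f Q, f R}"
    using similarity_convex_hull[OF f, of "{P, Q, R}"] by simp
  show "f ` V \<subseteq> convex hull {f P, f Q, f R}"
    using optimalD(1)[OF opt] hull by blast
  show "norm (f Q - f P) = norm (f R - f P)"
    using optimalD(2)[OF opt] by (simp add: similarity_norm[OF f])
  show "dbl_area (f P) (f Q) (f R) > 0"
    using optimalD(3)[OF opt] \<open>k > 0\<close> by (simp add: similarity_dbl_area[OF f])
  fix P' Q' R'
  assume *: "f ` V \<subseteq> convex hull {P', Q', R'}" "norm (Q' - P') = norm (R' - P')"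
    "dbl_area P' Q' R' > 0"
  obtain f' where f': "similarity (1 / k) f'" "\<And>x. f' (f x) = x" "\<And>x. f (f' x) = x"
    using similarity_inverse[OF f] by metis
  have "f' ` (f ` V) \<subseteq> convex hull {f' P', f' Q', f' R'}"
    using image_mono[OF *(1), of f'] similarity_convex_hull[OF f'(1), of "{P', Q', R'}"] by simp
  then have "V \<subseteq> convex hull {f' P', f' Q', f' R'}"
    by (simp add: image_image f'(2))
  moreover have "norm (f' Q' - f' P') = norm (f' R' - f' P')" "dbl_area (f' P') (f' Q') (f' R') > 0"
    using *(2,3) \<open>k > 0\<close> by (simp_all add: similarity_norm[OF f'(1)] similarity_dbl_area[OF f'(1)])
  ultimately have "dbl_area P Q R \<le> dbl_area (f' P') (f' Q') (f' R')"
    by (rule optimal_le[OF opt])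
  then show "dbl_area (f P) (f Q) (f R) \<le> dbl_area P' Q' R'"
    using \<open>k > 0\<close> by (simp add: similarity_dbl_area[OF f] similarity_dbl_area[OF f'(1)] field_simps)
qed

text \<open>The image of the container is optimal for the image of \<open>V\<close>, and the
  container itself competes with it. Hence the image cannot have the larger area.\<close>

lemma optimal_no_expansion:
  assumes opt: "optimal V P Q R" and f: "similarity k f" and sub: "f ` V \<subseteq> convex hull {P, Q, R}"
  shows "k \<le> 1"
proof -
  have "k > 0"
    using f by (simp add: similarity_def)
  have "dbl_area (f P) (f Q) (f R) \<le> dbl_area P Q R"
    using optimal_similarity[OF opt f] sub optimalD[OF opt] by (intro optimal_le)
  then have "k\<^sup>2 \<le> 1"
    using optimalD(3)[OF opt] by (simp add: similarity_dbl_area[OF f])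
  then show ?thesis
    using \<open>k > 0\<close> by (simp add: power_le_one_iff abs_square_le_1)
qed

text \<open>The competitor has apex \<open>X\<close> and keeps the longer side \<open>XY\<close>;
  the side \<open>XZ\<close> is prolonged to the same length. This multiplies the area of the
  triangle by the ratio of the two sides, whose denominator is cleared in the statement.\<close>

lemma optimal_apex_le:
  assumes opt: "optimal {X, Y, Z} P Q R" and pos: "dbl_area X Y Z > 0"
    and le: "norm (Z - X) \<le> norm (Y - X)"
  shows "dbl_area P Q R * norm (Z - X) \<le> dbl_area X Y Z * norm (Y - X)"
proof -
  have nz: "norm (Z - X) > 0"
    using pos by (auto simp: dbl_area_def crs_def)
  define t where "t = norm (Y - X) / norm (Z - X)"
  have "t \<ge> 1" "t > 0"
    using nz le by (auto simp: t_def field_simps intro: less_le_trans)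
  define Z' where "Z' = X + t *\<^sub>R (Z - X)"
  have ar: "dbl_area X Y Z' = t * dbl_area X Y Z"
  proof -
    have "crs (Y - X) (Z' - X) = t * crs (Y - X) (Z - X)"
      by (simp add: Z'_def crs_def algebra_simps)
    then show ?thesis
      using \<open>t > 0\<close> by (simp add: dbl_area_def abs_mult)
  qed
  have "Z = (1 - 1 / t) *\<^sub>R X + 0 *\<^sub>R Y + (1 / t) *\<^sub>R Z'"
    using \<open>t > 0\<close> by (simp add: Z'_def algebra_simps)
  then have "Z \<in> convex hull {X, Y, Z'}"
    unfolding convex_hull_3 using \<open>t \<ge> 1\<close>
    by (intro CollectI exI[of _ "1 - 1 / t"] exI[of _ 0] exI[of _ "1 / t"]) simp
  then have "{X, Y, Z} \<subseteq> convex hull {X, Y, Z'}"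
    by (simp add: hull_inc)
  moreover have "norm (Y - X) = norm (Z' - X)"
    using nz \<open>t > 0\<close> by (simp add: Z'_def t_def)
  ultimately have "dbl_area P Q R \<le> t * dbl_area X Y Z"
    using optimal_le[OF opt, of X Y Z'] pos \<open>t > 0\<close> ar by simp
  then show ?thesis
    using nz by (simp add: t_def field_simps)
qed

section \<open>Isosceles triangles with horizontal base and the standard position\<close>

abbreviation pt :: "real \<Rightarrow> real \<Rightarrow> plane" where
  "pt x y \<equiv> vector [x, y]"

text \<open>The half-planes bounded by the base and the legs. The slack in each inequality is a
  positive multiple of a barycentric coordinate, which yields both directions.\<close>

lemma mem_hull_tent:
  assumes "w > 0" "g > 0"
  shows "p \<in> convex hull {pt u (m + g), pt (u - w) m, pt (u + w) m} \<longleftrightarrow>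
    m \<le> p $ 2 \<and> w * (p $ 2 - m) \<le> g * (p $ 1 - u + w) \<and> w * (p $ 2 - m) \<le> g * (u + w - p $ 1)"
    (is "?L \<longleftrightarrow> ?R")
proof
  assume ?L
  then obtain a b c where abc: "a \<ge> 0" "b \<ge> 0" "c \<ge> 0" "a + b + c = 1"
    and p: "p = a *\<^sub>R pt u (m + g) + b *\<^sub>R pt (u - w) m + c *\<^sub>R pt (u + w) m"
    by (auto simp: convex_hull_3)
  have a: "a = 1 - b - c"
    using abc by simp
  have p12: "p $ 1 = u + (c - b) * w" "p $ 2 = m + a * g"
    by (simp_all add: p a algebra_simps)
  have "g * (p $ 1 - u + w) - w * (p $ 2 - m) = 2 * c * (g * w)"
    "g * (u + w - p $ 1) - w * (p $ 2 - m) = 2 * b * (g * w)"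
    unfolding p12 a by (simp_all add: algebra_simps)
  moreover have "2 * c * (g * w) \<ge> 0" "2 * b * (g * w) \<ge> 0"
    using abc assms by simp_all
  moreover have "a * g \<ge> 0"
    using abc assms by simp
  ultimately show ?R
    unfolding p12(2) by linarith
next
  assume R: ?R
  define a where "a = (p $ 2 - m) / g"
  define c where "c = (g * (p $ 1 - u + w) - w * (p $ 2 - m)) / (2 * g * w)"
  define b where "b = (g * (u + w - p $ 1) - w * (p $ 2 - m)) / (2 * g * w)"
  have "a \<ge> 0" "b \<ge> 0" "c \<ge> 0"
    using R assms by (simp_all add: a_def b_def c_def)
  moreover have "a + b + c = 1"
    using assms by (simp add: a_def b_def c_def field_simps)
  moreover have "p = a *\<^sub>R pt u (m + g) + b *\<^sub>R pt (u - w) m + c *\<^sub>R pt (u + w) m"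
    using assms by (simp add: plane_eq_iff a_def b_def c_def field_simps)
  ultimately show ?L
    by (auto simp: convex_hull_3)
qed

lemma dbl_area_tent:
  assumes "w > 0" "g > 0"
  shows "dbl_area (pt u (m + g)) (pt (u - w) m) (pt (u + w) m) = 2 * w * g"
  using assms by (simp add: dbl_area_def crs_def abs_mult)

lemma norm_tent: "norm (pt (u - w) m - pt u (m + g)) = norm (pt (u + w) m - pt u (m + g))"
proof -
  have "(norm (pt (u - w) m - pt u (m + g)))\<^sup>2 = (norm (pt (u + w) m - pt u (m + g)))\<^sup>2"
    unfolding norm_plane by simp
  then show ?thesis
    by simp
qed

text \<open>Every isosceles triangle is similar to one of these; the apex angle is acute iff \<open>h > 1\<close>.\<close>

abbreviation optimal_std :: "plane set \<Rightarrow> real \<Rightarrow> bool" where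
  "optimal_std V h \<equiv> optimal V (pt 0 h) (pt (-1) 0) (pt 1 0)"

lemma mem_hull_std:
  assumes "h > 0"
  shows "p \<in> convex hull {pt 0 h, pt (-1) 0, pt 1 0} \<longleftrightarrow>
    0 \<le> p $ 2 \<and> p $ 2 \<le> h * (1 + p $ 1) \<and> p $ 2 \<le> h * (1 - p $ 1)"
  using mem_hull_tent[of 1 h p 0 0] assms by (simp add: add.commute)

lemma mem_hull_std_sides:
  assumes "h > 0"
  shows "-1 \<le> x \<Longrightarrow> x \<le> 1 \<Longrightarrow> pt x 0 \<in> convex hull {pt 0 h, pt (-1) 0, pt 1 0}"
    and "0 \<le> s \<Longrightarrow> s \<le> 1 \<Longrightarrow> pt (s - 1) (s * h) \<in> convex hull {pt 0 h, pt (-1) 0, pt 1 0}"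
    and "0 \<le> s \<Longrightarrow> s \<le> 1 \<Longrightarrow> pt (1 - s) (s * h) \<in> convex hull {pt 0 h, pt (-1) 0, pt 1 0}"
  using assms mult_left_mono[of s "2 - s" h] mult_left_mono[of "-1" x h] mult_left_mono[of x 1 h]
  by (simp_all add: mem_hull_std algebra_simps)

lemma dbl_area_std: "h > 0 \<Longrightarrow> dbl_area (pt 0 h) (pt (-1) 0) (pt 1 0) = 2 * h"
  using dbl_area_tent[of 1 h 0 0] by simp

text \<open>The form in which competitors are used below: \<open>u\<close> locates the axis,
  \<open>m\<close> the height of the base, \<open>w\<close> is half the base and \<open>g\<close>
  the altitude.\<close>

lemma optimal_std_tent:
  assumes "optimal_std V h" "h > 0" "w > 0" "g > 0"
    and "\<And>p. p \<in> V \<Longrightarrow> m \<le> p $ 2 \<and> w * (p $ 2 - m) \<le> g * (p $ 1 - u + w)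
        \<and> w * (p $ 2 - m) \<le> g * (u + w - p $ 1)"
  shows "h \<le> w * g"
proof -
  have "V \<subseteq> convex hull {pt u (m + g), pt (u - w) m, pt (u + w) m}"
    using assms(5) mem_hull_tent[OF assms(3,4)] by blast
  then have "dbl_area (pt 0 h) (pt (-1) 0) (pt 1 0)
      \<le> dbl_area (pt u (m + g)) (pt (u - w) m) (pt (u + w) m)"
    using assms(3,4) by (intro optimal_le[OF assms(1)] norm_tent) (simp_all add: dbl_area_tent)
  then show ?thesis
    using assms(2-4) by (simp add: dbl_area_std dbl_area_tent)
qed

lemma similarity_reflection: "similarity 1 (\<lambda>p::plane. pt (- (p $ 1)) (p $ 2))"
proof -
  have "orthogonal_transformation (\<lambda>p::plane. pt (- (p $ 1)) (p $ 2))"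
    unfolding orthogonal_transformation_def
    by (auto intro!: linearI simp: plane_eq_iff inner_plane)
  then show ?thesis
    unfolding similarity_def by (intro conjI exI[of _ 0]) auto
qed

lemma optimal_std_reflection:
  assumes "optimal_std V h"
  shows "optimal_std ((\<lambda>p::plane. pt (- (p $ 1)) (p $ 2)) ` V) h"
  using optimal_similarity[OF assms similarity_reflection] by (simp add: optimal_swap)


section \<open>Contact of the points with the three sides\<close>

text \<open>Otherwise the left leg can be turned down about \<open>(-1, 0)\<close> until it meets a
  point. The isosceles triangle with this smaller base angle and the shortest sufficient base has
  smaller area.\<close>

lemma optimal_std_left_leg:
  assumes opt: "optimal_std V h" and h: "h > 0" and V: "finite V" "q0 \<in> V" "q0 $ 2 > 0"
  shows "\<exists>p\<in>V. p $ 2 = h * (1 + p $ 1) \<and> p $ 2 > 0"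
proof (rule ccontr)
  assume neg: "\<not> ?thesis"
  have mem: "0 \<le> p $ 2" "p $ 2 \<le> h * (1 + p $ 1)" "p $ 2 \<le> h * (1 - p $ 1)" if "p \<in> V" for p
    using that optimalD(1)[OF opt] mem_hull_std[OF h] by blast+
  have ge: "1 + p $ 1 \<ge> 0" if "p \<in> V" for p
    using mem(1,2)[OF that] h by (smt (verit) mult_pos_neg)
  \<comment> \<open>The steepest slope at which a point is seen from \<open>(-1, 0)\<close>. A point
    at that corner itself contributes the quotient 0, as division by zero gives 0.\<close>
  define \<sigma> where "\<sigma> = Max ((\<lambda>p. p $ 2 / (1 + p $ 1)) ` V)"
  have \<sigma>: "p $ 2 \<le> \<sigma> * (1 + p $ 1)" if "p \<in> V" for p
  proof (cases "1 + p $ 1 = 0")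
    case True
    then show ?thesis using mem(2)[OF that] by simp
  next
    case False
    have "p $ 2 / (1 + p $ 1) \<le> \<sigma>"
      unfolding \<sigma>_def using V(1) that by (intro Max_ge) auto
    then show ?thesis
      using False ge[OF that] by (simp add: field_simps)
  qed
  have "\<sigma> \<in> (\<lambda>p. p $ 2 / (1 + p $ 1)) ` V"
    unfolding \<sigma>_def using V by (intro Max_in) auto
  then obtain q where q: "q \<in> V" "\<sigma> = q $ 2 / (1 + q $ 1)"
    by auto
  have "\<sigma> < h"
  proof (cases "q $ 2 > 0")
    case True
    then have "q $ 2 < h * (1 + q $ 1)"
      using neg q(1) mem(2)[OF q(1)] by force
    moreover from this have "1 + q $ 1 > 0"
      using True h by (smt (verit) mult_nonneg_nonpos)
    ultimately show ?thesis
      by (simp only: q(2) pos_divide_less_eq)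
  next
    case False
    then show ?thesis
      using mem(1)[OF q(1)] q(2) h by simp
  qed
  have "\<sigma> > 0"
    using \<sigma>[OF V(2)] ge[OF V(2)] V(3) by (smt (verit) mult_nonpos_nonneg)
  \<comment> \<open>The least base length, measured from \<open>(-1, 0)\<close>, for which a right
    leg of slope \<open>-\<sigma>\<close> passes above all points; \<open>v\<close> is a point on
    that leg.\<close>
  define w where "w = Max ((\<lambda>p. 1 + p $ 1 + p $ 2 / \<sigma>) ` V)"
  have w: "1 + p $ 1 + p $ 2 / \<sigma> \<le> w" if "p \<in> V" for p
    unfolding w_def using V(1) that by (intro Max_ge) auto
  have "w \<in> (\<lambda>p. 1 + p $ 1 + p $ 2 / \<sigma>) ` V"
    unfolding w_def using V by (intro Max_in) auto
  then obtain v where v: "v \<in> V" "w = 1 + v $ 1 + v $ 2 / \<sigma>"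
    by auto
  have "w > 0"
    using w[OF V(2)] ge[OF V(2)] V(3) \<open>\<sigma> > 0\<close> by (smt (verit) divide_pos_pos)
  have "h \<le> (w / 2) * (\<sigma> * w / 2)"
  proof (rule optimal_std_tent[OF opt h, where m = 0 and u = "w / 2 - 1"])
    fix p assume p: "p \<in> V"
    have "p $ 2 \<le> \<sigma> * (w - (1 + p $ 1))"
      using w[OF p] \<open>\<sigma> > 0\<close> by (simp add: field_simps)
    then have "(w / 2) * (p $ 2) \<le> (w / 2) * (\<sigma> * (w - (1 + p $ 1)))"
      "(w / 2) * (p $ 2) \<le> (w / 2) * (\<sigma> * (1 + p $ 1))"
      using \<open>w > 0\<close> \<sigma>[OF p] by (intro mult_left_mono; simp)+
    then show "0 \<le> p $ 2 \<and> w / 2 * (p $ 2 - 0) \<le> \<sigma> * w / 2 * (p $ 1 - (w / 2 - 1) + w / 2) \<and>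
        w / 2 * (p $ 2 - 0) \<le> \<sigma> * w / 2 * (w / 2 - 1 + w / 2 - p $ 1)"
      using mem(1)[OF p] by (simp add: algebra_simps)
  qed (use \<open>w > 0\<close> \<open>\<sigma> > 0\<close> in auto)
  then have 1: "4 * h * \<sigma> \<le> (\<sigma> * w)\<^sup>2"
    using mult_left_mono[of h "(w / 2) * (\<sigma> * w / 2)" "4 * \<sigma>"] \<open>\<sigma> > 0\<close>
    by (simp add: power2_eq_square algebra_simps)
  \<comment> \<open>With \<open>(a, b)\<close> the position of \<open>v\<close> relative to the left
    corner, an isosceles triangle of slope \<open>k\<close> on a base from that corner whose right
    leg passes through \<open>v\<close> has area \<open>(k * a + b)\<^sup>2 / (4 * k)\<close>. For
    \<open>k = h\<close> this is at most \<open>h\<close>; it remains to see that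
    \<open>k = \<sigma>\<close> gives strictly less.\<close>
  define a where "a = 1 + v $ 1"
  define b where "b = v $ 2"
  have sw: "\<sigma> * w = \<sigma> * a + b"
    using v(2) \<open>\<sigma> > 0\<close> by (simp add: a_def b_def field_simps)
  have ab: "0 \<le> a" "0 \<le> b" "b \<le> \<sigma> * a" "h * a + b \<le> 2 * h"
    using ge[OF v(1)] mem[OF v(1)] \<sigma>[OF v(1)] by (simp_all add: a_def b_def algebra_simps)
  have "a > 0"
    using sw ab \<open>\<sigma> > 0\<close> \<open>w > 0\<close> by (smt (verit) mult_pos_pos mult_eq_0_iff)
  \<comment> \<open>The point \<open>v\<close> lies below both lines of slopes
    \<open>\<sigma>\<close> and \<open>h\<close>, so the second factor of the difference computed
    next is negative.\<close>
  have "b * b \<le> (\<sigma> * a) * (\<sigma> * a)"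
    using ab by (intro mult_mono) auto
  also have "\<dots> < (\<sigma> * a) * (h * a)"
    using \<open>\<sigma> > 0\<close> \<open>a > 0\<close> \<open>\<sigma> < h\<close> by simp
  finally have "(h - \<sigma>) * (b * b - \<sigma> * h * a * a) < 0"
    using \<open>\<sigma> < h\<close> by (intro mult_pos_neg) (simp_all add: algebra_simps)
  moreover have "(\<sigma> * a + b)\<^sup>2 * h - (h * a + b)\<^sup>2 * \<sigma> = (h - \<sigma>) * (b * b - \<sigma> * h * a * a)"
    by (simp add: power2_eq_square algebra_simps)
  ultimately have "(\<sigma> * a + b)\<^sup>2 * h < (h * a + b)\<^sup>2 * \<sigma>"
    by simp
  also have "\<dots> \<le> (2 * h)\<^sup>2 * \<sigma>"
    using ab h \<open>\<sigma> > 0\<close> by (intro mult_right_mono power_mono) auto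
  also have "\<dots> = (4 * h * \<sigma>) * h"
    by (simp add: power2_eq_square)
  also have "\<dots> \<le> (\<sigma> * a + b)\<^sup>2 * h"
    using 1 h sw by (intro mult_right_mono) auto
  finally show False
    by simp
qed

lemma optimal_std_right_leg:
  assumes opt: "optimal_std V h" and h: "h > 0" and V: "finite V" "q0 \<in> V" "q0 $ 2 > 0"
  shows "\<exists>p\<in>V. p $ 2 = h * (1 - p $ 1) \<and> p $ 2 > 0"
  using optimal_std_left_leg[OF optimal_std_reflection[OF opt] h, of "pt (- (q0 $ 1)) (q0 $ 2)"] V
  by auto

text \<open>Otherwise the base can be raised to the lowest point. The new container is the image of
  the old one under a contraction centred at the apex; \<open>q0\<close> prevents it from
  degenerating to a point.\<close>

lemma optimal_std_base:
  assumes opt: "optimal_std V h" and h: "h > 0" and V: "finite V" "q0 \<in> V" "q0 $ 2 < h"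
  shows "\<exists>p\<in>V. p $ 2 = 0"
proof (rule ccontr)
  assume neg: "\<not> ?thesis"
  have mem: "0 \<le> p $ 2" "p $ 2 \<le> h * (1 + p $ 1)" "p $ 2 \<le> h * (1 - p $ 1)" if "p \<in> V" for p
    using that optimalD(1)[OF opt] mem_hull_std[OF h] by blast+
  define m where "m = Min ((\<lambda>p. p $ 2) ` V)"
  have m: "m \<le> p $ 2" if "p \<in> V" for p
    unfolding m_def using V(1) that by (intro Min_le) auto
  have "m \<in> (\<lambda>p. p $ 2) ` V"
    unfolding m_def using V by (intro Min_in) auto
  then have "m > 0"
    using mem(1) neg by force
  have "m < h"
    using m[OF V(2)] V(3) by simp
  have "h \<le> (1 - m / h) * (h - m)"
  proof (rule optimal_std_tent[OF opt h, where m = m and u = 0])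
    fix p assume p: "p \<in> V"
    have "(h - m) / h * p $ 2 \<le> (h - m) / h * (h * (1 + p $ 1))"
      "(h - m) / h * p $ 2 \<le> (h - m) / h * (h * (1 - p $ 1))"
      using h \<open>m < h\<close> mem[OF p] by (intro mult_left_mono; simp)+
    then show "m \<le> p $ 2 \<and> (1 - m / h) * (p $ 2 - m) \<le> (h - m) * (p $ 1 - 0 + (1 - m / h)) \<and>
        (1 - m / h) * (p $ 2 - m) \<le> (h - m) * (0 + (1 - m / h) - p $ 1)"
      using m[OF p] h by (simp add: field_simps)
  qed (use h \<open>m < h\<close> in auto)
  also have "\<dots> < 1 * h"
    using h \<open>m > 0\<close> \<open>m < h\<close> by (intro mult_strict_mono) auto
  finally show False
    by simp
qed

section \<open>Excluding containers without a vertex of the triangle at the apex\<close>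

text \<open>Ensures that a point strictly inside a side stays on it when moved slightly along it, in
  either direction.\<close>

lemma small_perturbation_unit_interval:
  fixes s d :: real
  assumes "0 < s" "s < 1"
  shows "\<exists>\<delta>>0. \<forall>e. \<bar>e\<bar> \<le> \<delta> \<longrightarrow> 0 \<le> s + e * d \<and> s + e * d \<le> 1"
proof (intro exI[of _ "min s (1 - s) / (\<bar>d\<bar> + 1)"] conjI allI impI)
  show "0 < min s (1 - s) / (\<bar>d\<bar> + 1)"
    using assms by simp
  fix e assume "\<bar>e\<bar> \<le> min s (1 - s) / (\<bar>d\<bar> + 1)"
  then have "\<bar>e\<bar> * (\<bar>d\<bar> + 1) \<le> min s (1 - s)"
    by (simp add: field_simps)
  moreover have "\<bar>e * d\<bar> \<le> \<bar>e\<bar> * (\<bar>d\<bar> + 1)"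
    by (simp add: abs_mult mult_left_mono)
  ultimately show "0 \<le> s + e * d" "s + e * d \<le> 1"
    by linarith+
qed

text \<open>In complex notation this is the map
  \<open>z \<mapsto> (a + b i) z + (c + d i)\<close>.\<close>

lemma similarity_explicit:
  assumes k: "k = sqrt (a\<^sup>2 + b\<^sup>2)" "k > 0"
  shows "similarity k (\<lambda>p::plane. pt (c + a * p $ 1 - b * p $ 2) (d + b * p $ 1 + a * p $ 2))"
proof -
  have k2: "k\<^sup>2 = a\<^sup>2 + b\<^sup>2"
    using k by simp
  define g where "g = (\<lambda>p::plane. pt ((a * p $ 1 - b * p $ 2) / k) ((b * p $ 1 + a * p $ 2) / k))"
  have "linear g"
    unfolding g_def by (intro linearI) (simp_all add: plane_eq_iff add_divide_distrib[symmetric]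
        diff_divide_distrib[symmetric] algebra_simps)
  moreover have "g v \<bullet> g w = v \<bullet> w" for v w
  proof -
    have "g v \<bullet> g w = (a\<^sup>2 + b\<^sup>2) * (v \<bullet> w) / k\<^sup>2"
      unfolding g_def inner_plane by (simp add: power2_eq_square add_divide_distrib[symmetric]
        diff_divide_distrib[symmetric] algebra_simps)
    then show ?thesis
      using k2 k(2) by (metis nonzero_mult_div_cancel_left power_not_zero less_irrefl)
  qed
  ultimately have "orthogonal_transformation g"
    by (simp add: orthogonal_transformation_def)
  moreover have "(\<lambda>p::plane. pt (c + a * p $ 1 - b * p $ 2) (d + b * p $ 1 + a * p $ 2))
      = (\<lambda>p. pt c d + k *\<^sub>R g p)"
    using k(2) by (auto simp: fun_eq_iff g_def plane_eq_iff)
  ultimately show ?thesis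
    using k(2) unfolding similarity_def by blast
qed

text \<open>The maps \<open>p \<mapsto> p + e(a p + J p + v)\<close>, with \<open>J\<close> the rotation by a right angle, are similarities;
  \<open>a\<close> and \<open>v\<close> can be chosen so that each of the three points stays on its side. For
  \<open>e\<close> of the sign of \<open>a\<close> these maps expand.\<close>

lemma not_optimal_std_base_interior:
  assumes h: "h > 0" and x: "-1 < x" "x < 1" and s: "0 < s" "s < 1" and r: "0 < r" "r < 1"
  shows "\<not> optimal_std {pt x 0, pt (s - 1) (s * h), pt (1 - r) (r * h)} h"
proof
  assume opt: "optimal_std {pt x 0, pt (s - 1) (s * h), pt (1 - r) (r * h)} h"
  \<comment> \<open>The translation is \<open>(v, -x)\<close>, whose second entry keeps the first
    point on the base. The values of \<open>v\<close> and \<open>a\<close> solve the linear system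
    \<open>s_eq\<close>, \<open>r_eq\<close>, which says that the other two points move along their
    legs; \<open>dx\<close>, \<open>ds\<close>, \<open>dr\<close> are the speeds of the
    parameters.\<close>
  define v where "v = ((r + s) * h\<^sup>2 + s + r - 2) / (2 * h)"
  define a where "a = (r * h\<^sup>2 - h * v - 1 + r + x) / h"
  define dx where "dx = a * x + v"
  define ds where "ds = a * (s - 1) - s * h + v"
  define dr where "dr = - (a * (1 - r) - r * h + v)"
  have hv: "2 * (h * v) = (r + s) * h\<^sup>2 + s + r - 2"
    using h by (simp add: v_def)
  have ha: "h * a = r * h\<^sup>2 - h * v - 1 + r + x"
    using h by (simp add: a_def)
  have s_eq: "a * (s * h) + (s - 1) - x = h * ds"
    using hv ha unfolding ds_def by (simp add: algebra_simps power2_eq_square)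
  have r_eq: "a * (r * h) + (1 - r) - x = h * dr"
    using hv ha unfolding dr_def by (simp add: algebra_simps power2_eq_square)
  have x': "0 < (1 + x) / 2" "(1 + x) / 2 < 1"
    using x by auto
  obtain \<delta>1 where \<delta>1: "\<delta>1 > 0" "\<And>e. \<bar>e\<bar> \<le> \<delta>1 \<Longrightarrow> 0 \<le> (1 + x) / 2 + e * (dx / 2) \<and> (1 + x) / 2 + e * (dx / 2) \<le> 1"
    using small_perturbation_unit_interval[OF x', of "dx / 2"] by auto
  obtain \<delta>2 where \<delta>2: "\<delta>2 > 0" "\<And>e. \<bar>e\<bar> \<le> \<delta>2 \<Longrightarrow> 0 \<le> s + e * ds \<and> s + e * ds \<le> 1"
    using small_perturbation_unit_interval[OF s, of ds] by auto
  obtain \<delta>3 where \<delta>3: "\<delta>3 > 0" "\<And>e. \<bar>e\<bar> \<le> \<delta>3 \<Longrightarrow> 0 \<le> r + e * dr \<and> r + e * dr \<le> 1"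
    using small_perturbation_unit_interval[OF r, of dr] by auto
  \<comment> \<open>The sign makes \<open>e * a\<close> nonnegative. The rotation contributes
    \<open>e\<^sup>2\<close> to the squared ratio, so the expansion is strict even for
    \<open>a = 0\<close>.\<close>
  define e where "e = (if a \<ge> 0 then 1 else -1) * min \<delta>1 (min \<delta>2 \<delta>3)"
  have e: "\<bar>e\<bar> \<le> \<delta>1" "\<bar>e\<bar> \<le> \<delta>2" "\<bar>e\<bar> \<le> \<delta>3" "e \<noteq> 0" "e * a \<ge> 0"
    using \<delta>1(1) \<delta>2(1) \<delta>3(1) by (auto simp: e_def mult_nonneg_nonpos)
  define k where "k = sqrt ((1 + e * a)\<^sup>2 + e\<^sup>2)"
  have "1 ^ 2 \<le> (1 + e * a)\<^sup>2"
    using e(5) by (intro power_mono) auto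
  then have "1 < (1 + e * a)\<^sup>2 + e\<^sup>2"
    using e(4) by (smt (verit) one_power2 zero_less_power2)
  then have "k > 1"
    by (simp add: k_def)
  define f where "f = (\<lambda>p::plane. pt (e * v + (1 + e * a) * p $ 1 - e * p $ 2)
    (- (e * x) + e * p $ 1 + (1 + e * a) * p $ 2))"
  have "similarity k f"
    unfolding f_def using \<open>k > 1\<close> by (intro similarity_explicit) (simp_all add: k_def)
  moreover have "f ` {pt x 0, pt (s - 1) (s * h), pt (1 - r) (r * h)}
      \<subseteq> convex hull {pt 0 h, pt (-1) 0, pt 1 0}"
  proof -
    have "f (pt x 0) = pt (x + e * dx) 0"
      by (simp add: f_def dx_def algebra_simps)
    moreover have "f (pt (s - 1) (s * h)) = pt (s + e * ds - 1) ((s + e * ds) * h)"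
    proof -
      have "(s + e * ds) * h = s * h + e * (h * ds)"
        by (simp add: algebra_simps)
      then show ?thesis
        unfolding f_def s_eq[symmetric] by (simp add: plane_eq_iff ds_def algebra_simps)
    qed
    moreover have "f (pt (1 - r) (r * h)) = pt (1 - (r + e * dr)) ((r + e * dr) * h)"
    proof -
      have "(r + e * dr) * h = r * h + e * (h * dr)"
        by (simp add: algebra_simps)
      then show ?thesis
        unfolding f_def r_eq[symmetric] by (simp add: plane_eq_iff dr_def algebra_simps)
    qed
    moreover have "-1 \<le> x + e * dx" "x + e * dx \<le> 1"
      using \<delta>1(2)[OF e(1)] by (simp_all add: field_simps)
    ultimately show ?thesis
      using \<delta>2(2)[OF e(2)] \<delta>3(2)[OF e(3)] mem_hull_std_sides[OF h] by simp
  qed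
  ultimately have "k \<le> 1"
    by (rule optimal_no_expansion[OF opt])
  then show False
    using \<open>k > 1\<close> by simp
qed

text \<open>Slide the apex along the left leg to \<open>P' = (L - 1, L h)\<close> and let the right leg turn about
  \<open>(1 - r, r h)\<close>. The area is stationary at \<open>L = 1\<close> only if
  \<open>2 (1 - r) (1 + h\<^sup>2) = h\<^sup>2 - 1\<close>, and then the container with apex \<open>(-1, 0)\<close> and two sides
  along those of the triangle is smaller.\<close>

lemma not_optimal_std_base_left:
  assumes h: "h > 1" and s: "0 < s" "s < 1" and r: "0 < r" "r < 1"
  shows "\<not> optimal_std {pt (-1) 0, pt (s - 1) (s * h), pt (1 - r) (r * h)} h"
proof
  let ?X = "pt (-1) 0" and ?Z = "pt (s - 1) (s * h)" and ?Y = "pt (1 - r) (r * h)"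
  assume opt: "optimal_std {?X, ?Z, ?Y} h"
  \<comment> \<open>The length of a leg; \<open>d\<close> is the abscissa of \<open>?Y\<close>, and
    \<open>D2 L\<close> will be its squared distance from the moved apex.\<close>
  define l where "l = sqrt (1 + h\<^sup>2)"
  have l2: "l\<^sup>2 = 1 + h\<^sup>2" and "l > 0"
    using h by (simp_all add: l_def add_pos_nonneg)
  define d where "d = 1 - r"
  have d: "0 < d" "d < 1"
    using r by (auto simp: d_def)
  define D2 where "D2 = (\<lambda>L. (L - 1 - d)\<^sup>2 + h\<^sup>2 * (L - 1 + d)\<^sup>2)"
  have D2_1: "D2 1 = d\<^sup>2 * l\<^sup>2"
    unfolding D2_def l2 by (simp add: algebra_simps power2_eq_square)
  \<comment> \<open>Nonnegativity of \<open>G L\<close> encodes that the container with moved apex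
    is at least as large as the original one, with the square root removed.\<close>
  define G where "G = (\<lambda>L. L ^ 4 * d\<^sup>2 * l\<^sup>2 - D2 L)"
  have G1: "G 1 = 0"
    by (simp add: G_def D2_1)
  \<comment> \<open>The first condition keeps \<open>?Z\<close> on the left leg. The second says
    that \<open>?Y\<close> is no farther from the new apex than the leg is long, so the right leg
    reaches \<open>?Y\<close>.\<close>
  have G_nonneg: "0 \<le> G L" if L: "s \<le> L" "D2 L \<le> L\<^sup>2 * l\<^sup>2" for L
  proof -
    have "L > 0"
      using L s by simp
    have "D2 L > 0"
    proof (cases "L - 1 - d = 0")
      case True
      then have "h\<^sup>2 * (L - 1 + d)\<^sup>2 > 0"
        using d h by simp
      then show ?thesis
        using True by (simp add: D2_def)
    next
      case False
      then have "(L - 1 - d)\<^sup>2 > 0"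
        by simp
      moreover have "h\<^sup>2 * (L - 1 + d)\<^sup>2 \<ge> 0"
        by simp
      ultimately show ?thesis
        unfolding D2_def by linarith
    qed
    define D where "D = sqrt (D2 L)"
    have "D > 0" "D\<^sup>2 = D2 L"
      using \<open>D2 L > 0\<close> by (simp_all add: D_def)
    have "D \<le> L * l"
    proof (rule power2_le_imp_le)
      show "D\<^sup>2 \<le> (L * l)\<^sup>2"
        using L(2) \<open>D\<^sup>2 = D2 L\<close> by (simp add: power_mult_distrib)
      show "0 \<le> L * l"
        using \<open>L > 0\<close> \<open>l > 0\<close> by simp
    qed
    define t where "t = L * l / D"
    have "t \<ge> 1"
      using \<open>D \<le> L * l\<close> \<open>D > 0\<close> by (simp add: t_def)
    define P' where "P' = pt (L - 1) (L * h)"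
    define R' where "R' = P' + t *\<^sub>R (?Y - P')"
    have nYP: "(norm (?Y - P'))\<^sup>2 = D2 L"
      unfolding norm_plane by (simp add: P'_def D2_def d_def power2_eq_square algebra_simps)
    then have "norm (?Y - P') = D"
      by (simp add: D_def real_sqrt_unique)
    then have "norm (R' - P') = L * l"
      using \<open>D > 0\<close> \<open>L > 0\<close> \<open>l > 0\<close> by (simp add: R'_def t_def)
    moreover have "(norm (?X - P'))\<^sup>2 = (L * l)\<^sup>2"
      unfolding norm_plane power_mult_distrib l2 by (simp add: P'_def power2_eq_square algebra_simps)
    then have "norm (?X - P') = L * l"
      using \<open>L > 0\<close> \<open>l > 0\<close> by simp
    moreover have ar: "dbl_area P' ?X R' = t * L * (2 * h * d)"
    proof -
      have "crs (?X - P') (R' - P') = t * L * (2 * h * d)"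
        by (simp add: crs_def P'_def R'_def d_def algebra_simps)
      moreover have "0 \<le> t * L * (2 * h * d)"
        using \<open>t \<ge> 1\<close> \<open>L > 0\<close> h d by simp
      ultimately show ?thesis
        by (simp add: dbl_area_def)
    qed
    moreover have "{?X, ?Z, ?Y} \<subseteq> convex hull {P', ?X, R'}"
    proof -
      have "?Z = (s / L) *\<^sub>R P' + (1 - s / L) *\<^sub>R ?X + 0 *\<^sub>R R'"
        using \<open>L > 0\<close> by (simp add: plane_eq_iff P'_def field_simps)
      then have "?Z \<in> convex hull {P', ?X, R'}"
        unfolding convex_hull_3 using L(1) s \<open>L > 0\<close>
        by (intro CollectI exI[of _ "s / L"] exI[of _ "1 - s / L"] exI[of _ 0]) simp
      moreover have "?Y = (1 - 1 / t) *\<^sub>R P' + 0 *\<^sub>R ?X + (1 / t) *\<^sub>R R'"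
        using \<open>t \<ge> 1\<close> by (simp add: R'_def algebra_simps)
      then have "?Y \<in> convex hull {P', ?X, R'}"
        unfolding convex_hull_3 using \<open>t \<ge> 1\<close>
        by (intro CollectI exI[of _ "1 - 1 / t"] exI[of _ 0] exI[of _ "1 / t"]) simp
      ultimately show ?thesis
        by (simp add: hull_inc)
    qed
    moreover have "t * L * (2 * h * d) > 0"
      using \<open>t \<ge> 1\<close> \<open>L > 0\<close> h d by simp
    ultimately have "2 * h \<le> t * L * (2 * h * d)"
      using optimal_le[OF opt, of P' ?X R'] h by (simp add: dbl_area_std)
    then have "2 * h * 1 \<le> 2 * h * (t * L * d)"
      by (simp add: algebra_simps)
    then have "1 \<le> t * L * d"
      using h mult_le_cancel_left_pos[of "2 * h" 1 "t * L * d"] by linarith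
    then have "D \<le> L\<^sup>2 * l * d"
      using \<open>D > 0\<close> by (simp add: t_def field_simps power2_eq_square)
    then have "D\<^sup>2 \<le> (L\<^sup>2 * l * d)\<^sup>2"
      using \<open>D > 0\<close> by (intro power_mono) auto
    then show ?thesis
      unfolding G_def \<open>D\<^sup>2 = D2 L\<close> by (simp add: power_mult_distrib algebra_simps)
  qed
  \<comment> \<open>Both conditions are strict at \<open>L = 1\<close>, so the apex may slide in
    either direction and \<open>G\<close> has a local minimum there.\<close>
  have "\<forall>\<^sub>F L in at 1. 0 < L\<^sup>2 * l\<^sup>2 - D2 L"
  proof (rule order_tendstoD(1))
    show "((\<lambda>L. L\<^sup>2 * l\<^sup>2 - D2 L) \<longlongrightarrow> 1\<^sup>2 * l\<^sup>2 - D2 1) (at 1)"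
      unfolding D2_def by (intro tendsto_intros)
    have "d\<^sup>2 * l\<^sup>2 < 1 * l\<^sup>2"
      using d \<open>l > 0\<close> by (intro mult_strict_right_mono) (auto simp: power_less_one_iff)
    then show "0 < 1\<^sup>2 * l\<^sup>2 - D2 1"
      by (simp add: D2_1)
  qed
  moreover have "\<forall>\<^sub>F L in at 1. s < L"
    using s(2) by (intro order_tendstoD(1)[OF tendsto_ident_at])
  ultimately have "\<forall>\<^sub>F L in at 1. 0 \<le> G L"
    by eventually_elim (simp add: G_nonneg)
  then obtain \<delta> where "\<delta> > 0" and \<delta>: "\<And>L. L \<noteq> 1 \<Longrightarrow> dist L 1 < \<delta> \<Longrightarrow> 0 \<le> G L"
    unfolding eventually_at by auto
  have "G 1 \<le> G L" if "\<bar>1 - L\<bar> < \<delta>" for L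
    using \<delta>[of L] that G1 by (cases "L = 1") (auto simp: dist_real_def abs_minus_commute)
  moreover have "(G has_real_derivative (4 * d\<^sup>2 * l\<^sup>2 - (2 * (- d) + h\<^sup>2 * (2 * d)))) (at 1)"
    unfolding G_def D2_def by (auto intro!: derivative_eq_intros)
  ultimately have "4 * d\<^sup>2 * l\<^sup>2 - (2 * (- d) + h\<^sup>2 * (2 * d)) = 0"
    using \<open>\<delta> > 0\<close> by (intro DERIV_local_min) auto
  then have "2 * d * (2 * d * l\<^sup>2 - (h\<^sup>2 - 1)) = 0"
    by (simp add: power2_eq_square algebra_simps)
  then have crit: "2 * d * l\<^sup>2 = h\<^sup>2 - 1"
    using d by simp
  have "2 * d * l\<^sup>2 < 1 * l\<^sup>2"
    unfolding crit by (simp add: l2)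
  then have d2: "2 * d < 1"
    using \<open>l > 0\<close> by (simp only: mult_less_cancel_right_pos zero_less_power)
  \<comment> \<open>In the critical case \<open>y\<close> lies strictly between \<open>d * l\<close>
    and \<open>l\<close>. This contradicts the bound from the container with apex \<open>?X\<close>,
    whichever of the sides \<open>y\<close> and \<open>s * l\<close> of the triangle is
    longer.\<close>
  define y where "y = norm (?Y - ?X)"
  have "y\<^sup>2 = l\<^sup>2 + d\<^sup>2 * l\<^sup>2 + 2 * d * (1 - h\<^sup>2)"
    unfolding y_def norm_plane l2 by (simp add: d_def power2_eq_square algebra_simps)
  also have "\<dots> = l\<^sup>2 + d\<^sup>2 * l\<^sup>2 - 2 * d * (2 * d * l\<^sup>2)"
    unfolding crit by (simp add: algebra_simps)
  also have "\<dots> = (1 - 3 * d\<^sup>2) * l\<^sup>2"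
    by (simp add: algebra_simps power2_eq_square)
  finally have y2: "y\<^sup>2 = (1 - 3 * d\<^sup>2) * l\<^sup>2" .
  have "(2 * d)\<^sup>2 < 1"
    using d d2 power_strict_mono[of "2 * d" 1 2] by simp
  then have dd: "d\<^sup>2 < 1 - 3 * d\<^sup>2"
    by simp
  have "(d * l)\<^sup>2 < y\<^sup>2"
    unfolding y2 power_mult_distrib using dd \<open>l > 0\<close> by (intro mult_strict_right_mono) auto
  then have y_gt: "d * l < y"
    by (rule power2_less_imp_less) (simp add: y_def)
  have "y\<^sup>2 < 1 * l\<^sup>2"
    unfolding y2 using d \<open>l > 0\<close> by (intro mult_strict_right_mono) auto
  then have y_lt: "y < l"
    using \<open>l > 0\<close> by (intro power2_less_imp_less[of y l]) auto
  have "(norm (?Z - ?X))\<^sup>2 = (s * l)\<^sup>2"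
    unfolding norm_plane power_mult_distrib l2 by (simp add: power2_eq_square algebra_simps)
  then have nZ: "norm (?Z - ?X) = s * l"
    using s \<open>l > 0\<close> by simp
  have ar: "dbl_area ?X ?Z ?Y = 2 * h * (s * d)"
  proof -
    have "crs (?Z - ?X) (?Y - ?X) = - (2 * h * (s * d))"
      by (simp add: crs_def d_def algebra_simps)
    then show ?thesis
      using h s d by (simp add: dbl_area_def)
  qed
  have std: "dbl_area (pt 0 h) (pt (-1) 0) (pt 1 0) = 2 * h"
    using h by (simp add: dbl_area_std)
  have pos: "2 * h * (s * d) > 0"
    using h s d by simp
  show False
  proof (cases "y \<le> s * l")
    case True
    then have "2 * h * y \<le> 2 * h * (s * d) * (s * l)"
      using optimal_apex_le[OF opt] pos by (simp add: ar nZ std flip: y_def)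
    then have "2 * h * y \<le> 2 * h * (s * d * (s * l))"
      by (simp add: algebra_simps)
    then have "y \<le> s * d * (s * l)"
      using h by (simp only: mult_le_cancel_left_pos)
    also have "\<dots> = (s * s) * (d * l)"
      by simp
    also have "\<dots> \<le> 1 * (d * l)"
      using s d \<open>l > 0\<close> by (intro mult_right_mono mult_le_one) auto
    finally show False
      using y_gt by simp
  next
    case False
    have opt': "optimal_std {?X, ?Y, ?Z} h"
      using opt by (simp add: insert_commute)
    have "2 * h * (s * l) \<le> 2 * h * (s * d) * y"
      using optimal_apex_le[OF opt'] pos False
      by (simp add: ar dbl_area_swap[of ?X ?Y ?Z] nZ std flip: y_def)
    then have "(2 * h * s) * l \<le> (2 * h * s) * (d * y)"
      by (simp add: algebra_simps)
    then have "l \<le> d * y"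
      using h s by (simp only: mult_le_cancel_left_pos mult_pos_pos)
    also have "\<dots> \<le> 1 * y"
      using d by (intro mult_right_mono) (simp_all add: y_def)
    finally show False
      using y_lt by simp
  qed
qed

section \<open>A vertex of the triangle lies at an acute apex\<close>

text \<open>With the apex free, the contact points on the two legs and on the base are three
  distinct points, hence all the vertices. The position of the base point decides which exclusion
  applies.\<close>

lemma optimal_std_apex:
  assumes opt: "optimal_std {A, B, C} h" and h: "h > 1" and ABC: "dbl_area A B C > 0"
  shows "pt 0 h \<in> {A, B, C}"
proof (rule ccontr)
  assume apex: "pt 0 h \<notin> {A, B, C}"
  define V where "V = {A, B, C}"
  have opt: "optimal_std V h"
    using opt by (simp add: V_def)
  have "h > 0"
    using h by simp
  have mem: "0 \<le> p $ 2" "p $ 2 \<le> h * (1 + p $ 1)" "p $ 2 \<le> h * (1 - p $ 1)" if "p \<in> V" for p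
    using that optimalD(1)[OF opt] mem_hull_std[OF \<open>h > 0\<close>] by blast+
  have lt: "p $ 2 < h" if p: "p \<in> V" for p
  proof (rule ccontr)
    assume "\<not> ?thesis"
    then have "h * 1 \<le> h * (1 + p $ 1)" "h * 1 \<le> h * (1 - p $ 1)"
      using mem[OF p] by auto
    then have "p $ 1 = 0"
      using \<open>h > 0\<close> by (simp only: mult_le_cancel_left_pos)
    then have "p = pt 0 h"
      using mem[OF p] \<open>\<not> p $ 2 < h\<close> by (simp add: plane_eq_iff)
    then show False
      using apex p by (simp add: V_def)
  qed
  have "\<exists>q\<in>V. q $ 2 > 0"
  proof (rule ccontr)
    assume "\<not> ?thesis"
    then have "p $ 2 = 0" if "p \<in> V" for p
      using mem(1)[OF that] that by force
    then have "A $ 2 = 0" "B $ 2 = 0" "C $ 2 = 0"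
      by (simp_all add: V_def)
    then show False
      using ABC by (simp add: dbl_area_def crs_def)
  qed
  then obtain q0 where q0: "q0 \<in> V" "q0 $ 2 > 0"
    by blast
  have "finite V"
    by (simp add: V_def)
  obtain Z where Z: "Z \<in> V" "Z $ 2 = h * (1 + Z $ 1)" "Z $ 2 > 0"
    using optimal_std_left_leg[OF opt \<open>h > 0\<close> \<open>finite V\<close> q0] by blast
  obtain Y where Y: "Y \<in> V" "Y $ 2 = h * (1 - Y $ 1)" "Y $ 2 > 0"
    using optimal_std_right_leg[OF opt \<open>h > 0\<close> \<open>finite V\<close> q0] by blast
  obtain X where X: "X \<in> V" "X $ 2 = 0"
    using optimal_std_base[OF opt \<open>h > 0\<close> \<open>finite V\<close> Z(1) lt[OF Z(1)]] by blast
  define s where "s = 1 + Z $ 1"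
  define r where "r = 1 - Y $ 1"
  have s: "0 < s" "s < 1"
    using Z lt[OF Z(1)] \<open>h > 0\<close> by (auto simp: s_def zero_less_mult_iff mult_less_cancel_left2)
  have r: "0 < r" "r < 1"
    using Y lt[OF Y(1)] \<open>h > 0\<close> by (auto simp: r_def zero_less_mult_iff mult_less_cancel_left2)
  have XYZ: "X = pt (X $ 1) 0" "Z = pt (s - 1) (s * h)" "Y = pt (1 - r) (r * h)"
    using X Y Z by (simp_all add: plane_eq_iff s_def r_def)
  have "X \<noteq> Y" "X \<noteq> Z"
    using X Y Z by auto
  moreover have "Y \<noteq> Z"
  proof
    assume "Y = Z"
    then have "1 - r = s - 1" "r * h = s * h"
      using XYZ by (metis vector_2)+
    then show False
      using s r h by simp
  qed
  ultimately have "V = {X, Z, Y}"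
    using X(1) Y(1) Z(1) unfolding V_def by auto
  then have opt: "optimal_std {X, Z, Y} h"
    using opt by simp
  have x: "-1 \<le> X $ 1" "X $ 1 \<le> 1"
    using mem[OF X(1)] X(2) \<open>h > 0\<close> by (auto simp: zero_le_mult_iff)
  then consider "X $ 1 = -1" | "X $ 1 = 1" | "-1 < X $ 1" "X $ 1 < 1"
    by linarith
  then show False
  proof cases
    case 1
    then show False
      using opt XYZ not_optimal_std_base_left[OF h s r] by metis
  next
    case 2
    \<comment> \<open>Reflection moves the base point to the left corner and exchanges the roles of
      \<open>r\<close> and \<open>s\<close>.\<close>
    have "(\<lambda>p::plane. pt (- (p $ 1)) (p $ 2)) ` {X, Z, Y} = {pt (-1) 0, pt (r - 1) (r * h), pt (1 - s) (s * h)}"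
      using 2 X(2) XYZ(2,3) by (auto simp: plane_eq_iff)
    then show False
      using optimal_std_reflection[OF opt] not_optimal_std_base_left[OF h r s] by simp
  next
    case 3
    then show False
      using opt XYZ not_optimal_std_base_interior[OF \<open>h > 0\<close> _ _ s r, of "X $ 1"] by metis
  qed
qed

text \<open>The midpoint \<open>M\<close> of the base goes to the origin, half the base becomes the
  unit, and the median, perpendicular to the base because the legs are equal, is turned upright. The
  orientation is left open, hence the unordered pair.\<close>

lemma similarity_standard_position:
  assumes iso: "norm (Q - P) = norm (R - P)" and pos: "dbl_area P Q R > 0"
  obtains k h f where "similarity k f" "h > 0" "f P = pt 0 h" "{f Q, f R} = {pt (-1) 0, pt 1 0}"
proof -
  define M where "M = (1 / 2) *\<^sub>R (Q + R)"
  have QM: "Q - M = - (R - M)"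
    by (simp add: M_def algebra_simps flip: scaleR_2)
  have "dbl_area P Q R = 2 * \<bar>crs (P - M) (R - M)\<bar>"
  proof -
    have "crs (Q - P) (R - P) = - 2 * crs (P - M) (R - M)"
      by (simp add: crs_def M_def field_simps)
    then show ?thesis
      by (simp add: dbl_area_def abs_mult)
  qed
  then have "crs (P - M) (R - M) \<noteq> 0"
    using pos by auto
  then have "P - M \<noteq> 0" "R - M \<noteq> 0"
    by (auto simp: crs_def)
  have "(Q - P) \<bullet> (Q - P) = (R - P) \<bullet> (R - P)"
    using iso by (simp add: dot_square_norm)
  then have perp: "(P - M) \<bullet> (R - M) = 0"
    unfolding inner_plane M_def by (simp add: field_simps)
  have "norm (pt 0 (norm (P - M))) = norm (P - M)"
  proof -
    have "(norm (pt 0 (norm (P - M))))\<^sup>2 = (norm (P - M))\<^sup>2"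
      unfolding norm_plane[of "pt 0 (norm (P - M))"] by simp
    then show ?thesis
      by simp
  qed
  then obtain g where g: "orthogonal_transformation g" "g (P - M) = pt 0 (norm (P - M))"
    using orthogonal_transformation_exists[of "P - M" "pt 0 (norm (P - M))"] by metis
  have lin: "linear g" and inner: "\<And>v w. g v \<bullet> g w = v \<bullet> w"
    using g(1) by (auto simp: orthogonal_transformation_def)
  define k where "k = 1 / norm (R - M)"
  have "k > 0"
    using \<open>R - M \<noteq> 0\<close> by (simp add: k_def)
  define f where "f = (\<lambda>x. - (k *\<^sub>R g M) + k *\<^sub>R g x)"
  have f: "f x = k *\<^sub>R g (x - M)" for x
    by (simp add: f_def linear_diff[OF lin] algebra_simps)
  have "similarity k f"
    unfolding similarity_def f_def using g(1) \<open>k > 0\<close> by blast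
  moreover have "k * norm (P - M) > 0"
    using \<open>k > 0\<close> \<open>P - M \<noteq> 0\<close> by simp
  moreover have "f P = pt 0 (k * norm (P - M))"
    by (simp add: f g(2) plane_eq_iff)
  moreover have "{f Q, f R} = {pt (-1) 0, pt 1 0}"
  proof -
    define x where "x = f R $ 1"
    have "f R \<bullet> g (P - M) = 0"
      using perp by (simp add: f inner inner_commute)
    then have y: "f R $ 2 = 0"
      unfolding g(2) inner_plane using \<open>P - M \<noteq> 0\<close> by simp
    have "f R \<bullet> f R = 1"
      using \<open>R - M \<noteq> 0\<close> orthogonal_transformation_norm[OF g(1), of "R - M"]
      unfolding f k_def by (simp add: dot_square_norm power2_eq_square)
    then have "x\<^sup>2 = 1"
      using y by (simp add: inner_plane x_def power2_eq_square)
    then have "x = 1 \<or> x = -1"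
      by (simp add: power2_eq_1_iff)
    moreover have "f Q = - f R"
      unfolding f QM by (simp only: linear_neg[OF lin] scaleR_minus_right)
    then have "f R = pt x 0" "f Q = pt (- x) 0"
      using y by (simp_all add: plane_eq_iff x_def)
    ultimately show ?thesis
      by auto
  qed
  ultimately show thesis
    by (rule that)
qed

lemma optimal_acute_apex:
  assumes opt: "optimal {A, B, C} P Q R" and ABC: "dbl_area A B C > 0"
    and acute: "(Q - P) \<bullet> (R - P) > 0"
  shows "P \<in> {A, B, C}"
proof -
  obtain k h f where f: "similarity k f" "h > 0" "f P = pt 0 h" "{f Q, f R} = {pt (-1) 0, pt 1 0}"
    using similarity_standard_position[OF optimalD(2,3)[OF opt]] by metis
  have "k > 0"
    using f(1) by (simp add: similarity_def)
  have "optimal (f ` {A, B, C}) (f P) (f Q) (f R)"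
    by (rule optimal_similarity[OF opt f(1)])
  moreover have QR: "f Q = pt (-1) 0 \<and> f R = pt 1 0 \<or> f Q = pt 1 0 \<and> f R = pt (-1) 0"
    using f(4) by (auto simp: doubleton_eq_iff)
  ultimately have "optimal_std {f A, f B, f C} h"
    using f(3) optimal_swap by auto
  moreover have "dbl_area (f A) (f B) (f C) > 0"
    using ABC \<open>k > 0\<close> by (simp add: similarity_dbl_area[OF f(1)])
  moreover have "h > 1"
  proof -
    \<comment> \<open>In standard position this inner product equals
      \<open>h * h - 1\<close>.\<close>
    have "(f Q - f P) \<bullet> (f R - f P) > 0"
      using acute \<open>k > 0\<close> by (simp add: similarity_inner[OF f(1)])
    then have "h * h > 1"
      using QR f(3) by (auto simp: inner_plane)
    then show ?thesis
      using f(2) by (smt (verit) mult_le_one)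
  qed
  ultimately have "f P \<in> {f A, f B, f C}"
    unfolding f(3) by (intro optimal_std_apex)
  moreover have "x = y" if "f x = f y" for x y
    using similarity_inverse[OF f(1)] that by metis
  ultimately show ?thesis
    by auto
qed

section \<open>Optimal containers with apex at a vertex of the triangle\<close>

text \<open>Compare with the container that has apex \<open>X\<close>, the angle of
  the triangle at \<open>X\<close> and the longer of the two sides there. In the basis given by the legs, minimality
  forces all the estimates below to be equalities.\<close>

lemma optimal_common_apex_oriented:
  assumes opt: "optimal {X, V, W} X Q R" and acute: "(Q - X) \<bullet> (R - X) \<ge> 0"
    and le: "norm (W - X) \<le> norm (V - X)" and pos: "dbl_area X V W > 0"
    and V: "V - X = v1 *\<^sub>R (Q - X) + v2 *\<^sub>R (R - X)" "0 \<le> v1" "0 \<le> v2" "v1 + v2 \<le> 1"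
    and W: "W - X = w1 *\<^sub>R (Q - X) + w2 *\<^sub>R (R - X)" "0 \<le> w1" "0 \<le> w2"
    and D: "0 \<le> v1 * w2 - v2 * w1"
  shows "V = Q \<and> R \<in> ray X W"
proof -
  define L where "L = norm (Q - X)"
  have L: "norm (R - X) = L"
    using optimalD(2)[OF opt] by (simp add: L_def)
  have area: "dbl_area X Q R > 0"
    using optimalD(3)[OF opt] .
  have "Q - X \<noteq> 0"
    using area by (auto simp: dbl_area_def crs_def)
  then have "L > 0"
    by (simp add: L_def)
  have ar: "dbl_area X V W = (v1 * w2 - v2 * w1) * dbl_area X Q R"
  proof -
    have "crs (V - X) (W - X) = (v1 * w2 - v2 * w1) * crs (Q - X) (R - X)"
      unfolding V(1) W(1) by (simp add: crs_def algebra_simps)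
    then show ?thesis
      using D by (simp add: dbl_area_def abs_mult)
  qed
  then have D_pos: "v1 * w2 - v2 * w1 > 0"
    using pos area by (simp add: zero_less_mult_iff)
  have D_le: "v1 * w2 - v2 * w1 \<le> v1 * w2"
    using V W by simp
  then have "v1 * w2 > 0"
    using D_pos by simp
  then have "v1 > 0" "w2 > 0"
    using V(2) W(3) by (auto simp: zero_less_mult_iff)
  have "dbl_area X Q R * norm (W - X) \<le> dbl_area X Q R * ((v1 * w2 - v2 * w1) * norm (V - X))"
    using optimal_apex_le[OF opt pos le] ar by (simp add: algebra_simps)
  \<comment> \<open>The chain starts here: \<open>norm (W - X)\<close> is at most the determinant
    times \<open>norm (V - X)\<close>, hence at most \<open>v1 * w2 * L\<close>. Since the angle is
    not obtuse, it is also at least \<open>w2 * L\<close>, so \<open>v1 = 1\<close>; then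
    \<open>w1\<close> vanishes as well.\<close>
  then have 1: "norm (W - X) \<le> (v1 * w2 - v2 * w1) * norm (V - X)"
    using area by (simp only: mult_le_cancel_left_pos)
  have "norm (V - X) \<le> v1 * L + v2 * L"
    unfolding V(1) using V(2,3) L norm_triangle_ineq[of "v1 *\<^sub>R (Q - X)" "v2 *\<^sub>R (R - X)"]
    by (simp add: L_def)
  also have "\<dots> \<le> 1 * L"
    unfolding distrib_right[symmetric] using V(4) \<open>L > 0\<close> by (intro mult_right_mono) auto
  finally have "(v1 * w2 - v2 * w1) * norm (V - X) \<le> (v1 * w2) * L"
    using D_pos D_le \<open>v1 * w2 > 0\<close> by (intro mult_mono) auto
  then have 2: "norm (W - X) \<le> v1 * (w2 * L)"
    using 1 by (simp add: algebra_simps)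
  have "(Q - X) \<bullet> (Q - X) = L\<^sup>2" "(R - X) \<bullet> (R - X) = L\<^sup>2"
    using L by (simp_all add: L_def dot_square_norm)
  then have "(norm (W - X))\<^sup>2 = (w1 * L)\<^sup>2 + (w2 * L)\<^sup>2 + 2 * (w1 * w2 * ((Q - X) \<bullet> (R - X)))"
    unfolding W(1) power2_norm_eq_inner
    by (simp add: inner_add_left inner_add_right inner_commute[of "R - X" "Q - X"]
        power_mult_distrib power2_eq_square[of w1] power2_eq_square[of w2] distrib_left)
  moreover have "w1 * w2 * ((Q - X) \<bullet> (R - X)) \<ge> 0"
    using W acute by simp
  ultimately have 3: "(w1 * L)\<^sup>2 + (w2 * L)\<^sup>2 \<le> (norm (W - X))\<^sup>2"
    by simp
  then have "(w2 * L)\<^sup>2 \<le> (norm (W - X))\<^sup>2"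
    by (smt (verit) zero_le_power2)
  then have "w2 * L \<le> norm (W - X)"
    by (rule power2_le_imp_le) simp
  then have "(w2 * L) * 1 \<le> (w2 * L) * v1"
    using 2 by (simp add: algebra_simps)
  then have "1 \<le> v1"
    using \<open>w2 > 0\<close> \<open>L > 0\<close> by (simp only: mult_le_cancel_left_pos mult_pos_pos)
  then have v: "v1 = 1" "v2 = 0"
    using V by auto
  then have "(norm (W - X))\<^sup>2 \<le> (w2 * L)\<^sup>2"
    using 2 by (intro power_mono) auto
  then have "(w1 * L)\<^sup>2 \<le> 0"
    using 3 by linarith
  then have "w1 = 0"
    using \<open>L > 0\<close> by simp
  then have "R = X + (1 / w2) *\<^sub>R (W - X)"
    using W(1) \<open>w2 > 0\<close> by simp
  then have "R \<in> ray X W"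
    unfolding ray_def using \<open>w2 > 0\<close> by (intro CollectI exI[of _ "1 / w2"]) auto
  moreover have "V = Q"
    using V(1) v by simp
  ultimately show ?thesis
    by blast
qed

lemma mem_hull_3_from_vertex:
  fixes X :: plane
  assumes "p \<in> convex hull {X, Q, R}"
  obtains a b where "p - X = a *\<^sub>R (Q - X) + b *\<^sub>R (R - X)" "0 \<le> a" "0 \<le> b" "a + b \<le> 1"
proof -
  obtain u a b where *: "0 \<le> u" "0 \<le> a" "0 \<le> b" "u + a + b = 1" "p = u *\<^sub>R X + a *\<^sub>R Q + b *\<^sub>R R"
    using assms by (auto simp: convex_hull_3)
  have u: "u = 1 - a - b"
    using * by simp
  have "p - X = a *\<^sub>R (Q - X) + b *\<^sub>R (R - X)"
    unfolding *(5) u by (simp add: algebra_simps)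
  then show thesis
    using that *(1-4) by simp
qed

text \<open>The sign of the determinant tells on which side of \<open>XW\<close> the point
  \<open>V\<close> lies; if it is negative, the base vertices \<open>Q\<close> and \<open>R\<close>
  exchange roles.\<close>

lemma optimal_common_apex:
  assumes opt: "optimal {X, V, W} X Q R" and acute: "(Q - X) \<bullet> (R - X) \<ge> 0"
    and le: "norm (W - X) \<le> norm (V - X)" and pos: "dbl_area X V W > 0"
  shows "\<exists>S\<in>ray X W. dist X S = dist X V \<and> convex hull {X, Q, R} = convex hull {X, V, S}"
proof -
  have "V \<in> convex hull {X, Q, R}" "W \<in> convex hull {X, Q, R}"
    using optimalD(1)[OF opt] by auto
  then obtain v1 v2 w1 w2 where
    V: "V - X = v1 *\<^sub>R (Q - X) + v2 *\<^sub>R (R - X)" "0 \<le> v1" "0 \<le> v2" "v1 + v2 \<le> 1" and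
    W: "W - X = w1 *\<^sub>R (Q - X) + w2 *\<^sub>R (R - X)" "0 \<le> w1" "0 \<le> w2"
    by (metis mem_hull_3_from_vertex)
  have dist: "dist X Q = dist X R"
    using optimalD(2)[OF opt] by (simp add: dist_norm norm_minus_commute)
  show ?thesis
  proof (cases "0 \<le> v1 * w2 - v2 * w1")
    case True
    then have "V = Q \<and> R \<in> ray X W"
      by (rule optimal_common_apex_oriented[OF opt acute le pos V W])
    then show ?thesis
      using dist by auto
  next
    case False
    have "V = R \<and> Q \<in> ray X W"
      using False V W acute optimal_swap[of "{X, V, W}" X Q R] opt le pos
      by (intro optimal_common_apex_oriented[where ?v1.0 = v2 and ?v2.0 = v1 and ?w1.0 = w2 and ?w2.0 = w1])
        (auto simp: inner_commute add.commute algebra_simps)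
    then show ?thesis
      using dist by (auto simp: insert_commute)
  qed
qed

section \<open>Angles, vertices of a region, and the conclusion\<close>

text \<open>A nonpositive cosine has \<open>arccos\<close> at least \<open>pi / 2\<close>.
  Degenerate angles are covered too, since the quotient is then 0.\<close>

lemma angle_at_less_right_angle:
  assumes "angle_at Q P R < pi / 2"
  shows "(P - Q) \<bullet> (R - Q) > 0"
proof (rule ccontr)
  let ?c = "((P - Q) \<bullet> (R - Q)) / (norm (P - Q) * norm (R - Q))"
  assume "\<not> ?thesis"
  then have "?c \<le> 0"
    by (simp add: divide_nonpos_nonneg)
  moreover have "\<bar>?c\<bar> \<le> 1"
    using divide_right_mono[OF Cauchy_Schwarz_ineq2[of "P - Q" "R - Q"],
        of "norm (P - Q) * norm (R - Q)"]
    by (cases "P = Q \<or> R = Q") (auto simp: abs_mult)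
  then have "-1 \<le> ?c"
    by linarith
  ultimately have "arccos 0 \<le> arccos ?c"
    by (intro arccos_le_arccos) auto
  then show False
    using assms by (simp add: angle_at_def)
qed

text \<open>The vertices are the extreme points. This links the labelling that witnesses acuteness
  to the one that witnesses equal legs.\<close>

lemma triangle_vertices_unique:
  assumes "convex hull {P, Q, R} = convex hull {P', Q', R'}"
    and "\<not> collinear {P, Q, R}" "\<not> collinear {P', Q', R' :: plane}"
  shows "{P, Q, R} = {P', Q', R'}"
proof -
  have "x extreme_point_of (convex hull {P, Q, R}) \<longleftrightarrow> x \<in> {P, Q, R}" for x
    using assms(2) affine_dependent_imp_collinear_3
    by (intro extreme_point_of_convex_hull_affine_independent) blast
  moreover have "x extreme_point_of (convex hull {P', Q', R'}) \<longleftrightarrow> x \<in> {P', Q', R'}" for x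
    using assms(3) affine_dependent_imp_collinear_3
    by (intro extreme_point_of_convex_hull_affine_independent) blast
  ultimately show ?thesis
    unfolding assms(1) by blast
qed

theorem theorem1p4:
  fixes A B C :: plane and T' :: "plane set"
  assumes "\<not> collinear {A, B, C}"
    and "dist B C < dist A C"
    and "dist A C < dist A B"
    and "min_area_isosceles_container (convex hull {A, B, C}) T'"
    and "acute_triangle T'"
  shows "special_container_first_kind A B C T'"
proof -
  have ABC: "dbl_area A B C > 0"
    using assms(1) dbl_area_nonneg[of A B C] by (simp add: collinear_iff_dbl_area)
  obtain P Q R where ncol: "\<not> collinear {P, Q, R}" and T': "T' = convex hull {P, Q, R}"
    and iso: "dist P Q = dist P R" and sub: "convex hull {A, B, C} \<subseteq> T'"
    using assms(4) unfolding min_area_isosceles_container_def isosceles_container_def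
      isosceles_triangle_def triangle_with_vertices_def by blast
  have opt: "optimal {A, B, C} P Q R"
    unfolding optimal_def
  proof (intro conjI allI impI)
    show "{A, B, C} \<subseteq> convex hull {P, Q, R}"
      using sub hull_subset[of "{A, B, C}" convex] T' by blast
    show "norm (Q - P) = norm (R - P)"
      using iso by (simp add: dist_norm norm_minus_commute)
    show "dbl_area P Q R > 0"
      using ncol dbl_area_nonneg[of P Q R] by (simp add: collinear_iff_dbl_area)
    fix P' Q' R'
    assume *: "{A, B, C} \<subseteq> convex hull {P', Q', R'}" "norm (Q' - P') = norm (R' - P')"
      "dbl_area P' Q' R' > 0"
    have "convex hull {A, B, C} \<subseteq> convex hull {P', Q', R'}"
      using *(1) by (intro hull_minimal) auto
    moreover have "\<not> collinear {P', Q', R'}" "dist P' Q' = dist P' R'"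
      using *(2,3) by (simp_all add: collinear_iff_dbl_area dist_norm norm_minus_commute)
    ultimately have "isosceles_container (convex hull {A, B, C}) (convex hull {P', Q', R'})"
      unfolding isosceles_container_def isosceles_triangle_def triangle_with_vertices_def by blast
    then have "area T' \<le> area (convex hull {P', Q', R'})"
      using assms(4) unfolding min_area_isosceles_container_def by blast
    then show "dbl_area P Q R \<le> dbl_area P' Q' R'"
      by (simp add: T' area_triangle)
  qed
  have acute: "(Q - P) \<bullet> (R - P) > 0"
  proof -
    obtain P' Q' R' where *: "\<not> collinear {P', Q', R'}" "T' = convex hull {P', Q', R'}"
      and angles: "angle_at P' Q' R' < pi / 2" "angle_at Q' R' P' < pi / 2" "angle_at R' P' Q' < pi / 2"
      using assms(5) unfolding acute_triangle_def triangle_with_vertices_def by blast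
    have eq: "{P, Q, R} = {P', Q', R'}"
      using triangle_vertices_unique[OF _ ncol *(1)] *(2) T' by simp
    have "P \<noteq> Q" "P \<noteq> R" "Q \<noteq> R"
      using ncol by (auto simp: collinear_iff_dbl_area dbl_area_def crs_def)
    then consider "P = P'" "Q = Q'" "R = R'" | "P = P'" "Q = R'" "R = Q'"
      | "P = Q'" "Q = P'" "R = R'" | "P = Q'" "Q = R'" "R = P'"
      | "P = R'" "Q = P'" "R = Q'" | "P = R'" "Q = Q'" "R = P'"
      using eq by (smt (verit) insertE insertI1 insertI2 singletonD)
    then show ?thesis
      using angles[THEN angle_at_less_right_angle] by cases (simp_all add: inner_commute)
  qed
  then have acute': "(Q - P) \<bullet> (R - P) \<ge> 0"
    by simp
  have perm: "dbl_area B A C > 0" "dbl_area C A B > 0"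
    using ABC by (simp_all add: dbl_area_def crs_def algebra_simps abs_if split: if_splits)
  consider "P = A" | "P = B" | "P = C"
    using optimal_acute_apex[OF opt ABC acute] by blast
  then show ?thesis
  \<comment> \<open>At \<open>A\<close>, \<open>B\<close> and \<open>C\<close> the longer side of
    the triangle is \<open>AB\<close>, \<open>BA\<close> and \<open>CA\<close> respectively;
    prolonging the other one yields \<open>C'\<close>, \<open>C''\<close> and
    \<open>B'\<close>.\<close>
  proof cases
    case 1
    then obtain S where "S \<in> ray A C" "dist A S = dist A B"
      and S: "convex hull {A, Q, R} = convex hull {A, B, S}"
      using optimal_common_apex[of A B C Q R] opt ABC acute' assms(3)
      by (auto simp: dist_norm norm_minus_commute)
    then show ?thesis
      unfolding special_container_first_kind_def T' using 1 by auto
  next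
    case 2
    have "optimal {B, A, C} B Q R"
      using opt 2 by (simp add: insert_commute)
    then obtain S where "S \<in> ray B C" "dist B S = dist B A"
      and "convex hull {B, Q, R} = convex hull {B, A, S}"
      using optimal_common_apex[of B A C Q R] 2 perm acute' assms(2,3)
      by (auto simp: dist_norm norm_minus_commute)
    moreover from this have "dist B S = dist A B" "T' = convex hull {A, B, S}"
      using 2 T' by (simp_all add: dist_commute insert_commute[of B A])
    ultimately show ?thesis
      unfolding special_container_first_kind_def by blast
  next
    case 3
    have "optimal {C, A, B} C Q R"
      using opt 3 by (simp add: insert_commute)
    then obtain S where "S \<in> ray C B" "dist C S = dist C A"
      and "convex hull {C, Q, R} = convex hull {C, A, S}"
      using optimal_common_apex[of C A B Q R] 3 perm acute' assms(2)
      by (auto simp: dist_norm norm_minus_commute)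
    moreover from this have "dist S C = dist A C" "T' = convex hull {A, S, C}"
      using 3 T' by (simp_all add: dist_commute insert_commute[of C A] insert_commute[of C S])
    ultimately show ?thesis
      unfolding special_container_first_kind_def by blast
  qed
qed

end
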